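(* Let $0<\mu\le L$. There exists a function $f:\mathbb{R}\times\mathbb{R}\to\mathbb{R}$ in $S_{\mu,L}$ (with $d_x=d_y=1$) such that Inexact Sim-GDA with any constant step size loses linear convergence when $\alpha\ge\frac{\mu}{L}$; that is, for every $\alpha\in[0,1)$ with $\alpha\ge\frac{\mu}{L}$ there exist inexact partial gradients $\widetilde\nabla_xf,\widetilde\nabla_yf$ of $f$ with relative error $\alpha$ such that for every $\eta>0$ Inexact Sim-GDA with $\eta_x=\eta_y=\eta$ does not converge linearly.
   Context: The problem is $\min_{x\in\mathbb{R}^{d_x}}\max_{y\in\mathbb{R}^{d_y}}f(x,y)$. Write $z=(x,y)$ and $g(z)=(\nabla_xf(x,y),-\nabla_yf(x,y))\in\mathbb{R}^{d_x+d_y}$. $f\in S_{\mu,L}$ means: $f$ is continuously differentiable, convex in $x$ and concave in $y$, and for all $z^0,z^1\in\mathbb{R}^{d_x+d_y}$, $\langle g(z^1)-g(z^0),z^1-z^0\rangle\ge\mu\|z^1-z^0\|_2^2$ and $\|g(z^1)-g(z^0)\|_2\le L\|z^1-z^0\|_2$. The saddle point $z^*$ is the point with $g(z^* )=0$. Inexact partial gradients with relative error $\alpha$: maps $\widetilde\nabla_xf,\widetilde\nabla_yf$ such that for all $x,y$, $$\|\widetilde\nabla_xf(x,y)-\nabla_xf(x,y)\|_2^2+\|\widetilde\nabla_yf(x,y)-\nabla_yf(x,y)\|_2^2\le\alpha^2\left(\|\nabla_xf(x,y)\|_2^2+\|\nabla_yf(x,y)\|_2^2\right).$$ Inexact Sim-GDA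 with step sizes $\eta_x,\eta_y$, started from $z^0=(x^0,y^0)$: for $k=0,1,2,\dots$, $x^{k+1}=x^k-\eta_x\widetilde\nabla_xf(x^k,y^k)$, $y^{k+1}=y^k+\eta_y\widetilde\nabla_yf(x^k,y^k)$, and $z^k=(x^k,y^k)$. The method converges linearly (for given $f$, inexact gradients and step sizes) if there are $C>0$ and $\rho\in[0,1)$ such that for every starting point $z^0$ and all $k\ge0$, $\|z^k-z^*\|_2\le C\rho^k\|z^0-z^*\|_2$. *)

theory Defs
  imports "HOL-Analysis.Analysis"
begin

text \<open>The product type carries the Euclidean norm and inner product, so a pair \<open>z = (x, y)\<close>
  is the concatenated vector. The operators below are meaningful only where the respective
  partial gradient exists, which holds everywhere for members of \<open>saddle_class\<close>.\<close>

definition grad_x :: "('a::euclidean_space \<times> 'b::euclidean_space \<Rightarrow> real) \<Rightarrow> 'a \<times> 'b \<Rightarrow> 'a" where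
  "grad_x f z = (THE D. GDERIV (\<lambda>x. f (x, snd z)) (fst z) :> D)"

definition grad_y :: "('a::euclidean_space \<times> 'b::euclidean_space \<Rightarrow> real) \<Rightarrow> 'a \<times> 'b \<Rightarrow> 'b" where
  "grad_y f z = (THE D. GDERIV (\<lambda>y. f (fst z, y)) (snd z) :> D)"

definition saddle_grad ::
    "('a::euclidean_space \<times> 'b::euclidean_space \<Rightarrow> real) \<Rightarrow> 'a \<times> 'b \<Rightarrow> 'a \<times> 'b" where
  "saddle_grad f z = (grad_x f z, - grad_y f z)"

definition continuously_differentiable :: "('a::euclidean_space \<Rightarrow> real) \<Rightarrow> bool" where
  "continuously_differentiable f \<longleftrightarrow>
     (\<exists>G. (\<forall>z. GDERIV f z :> G z) \<and> continuous_on UNIV G)"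

definition saddle_class ::
    "real \<Rightarrow> real \<Rightarrow> ('a::euclidean_space \<times> 'b::euclidean_space \<Rightarrow> real) set" where
  "saddle_class \<mu> L = {f.
     continuously_differentiable f \<and>
     (\<forall>y. convex_on UNIV (\<lambda>x. f (x, y))) \<and>
     (\<forall>x. concave_on UNIV (\<lambda>y. f (x, y))) \<and>
     (\<forall>z0 z1. (saddle_grad f z1 - saddle_grad f z0) \<bullet> (z1 - z0) \<ge> \<mu> * (norm (z1 - z0))\<^sup>2) \<and>
     (\<forall>z0 z1. norm (saddle_grad f z1 - saddle_grad f z0) \<le> L * norm (z1 - z0))}"

text \<open>For \<open>f \<in> saddle_class \<mu> L\<close> with \<open>\<mu> > 0\<close>, the map \<open>saddle_grad f\<close> is strongly monotone and
  Lipschitz, so it has exactly one zero and the description below is proper.\<close>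

definition saddle_point ::
    "('a::euclidean_space \<times> 'b::euclidean_space \<Rightarrow> real) \<Rightarrow> 'a \<times> 'b" where
  "saddle_point f = (THE z. saddle_grad f z = 0)"

definition inexact_gradients ::
    "('a::euclidean_space \<times> 'b::euclidean_space \<Rightarrow> real) \<Rightarrow> real \<Rightarrow>
     ('a \<times> 'b \<Rightarrow> 'a) \<Rightarrow> ('a \<times> 'b \<Rightarrow> 'b) \<Rightarrow> bool" where
  "inexact_gradients f \<alpha> gx gy \<longleftrightarrow>
     (\<forall>z. (norm (gx z - grad_x f z))\<^sup>2 + (norm (gy z - grad_y f z))\<^sup>2
        \<le> \<alpha>\<^sup>2 * ((norm (grad_x f z))\<^sup>2 + (norm (grad_y f z))\<^sup>2))"

primrec sim_gda ::
    "('a::euclidean_space \<times> 'b::euclidean_space \<Rightarrow> 'a) \<Rightarrow> ('a \<times> 'b \<Rightarrow> 'b) \<Rightarrow>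
     real \<Rightarrow> real \<Rightarrow> 'a \<times> 'b \<Rightarrow> nat \<Rightarrow> 'a \<times> 'b" where
  "sim_gda gx gy \<eta>x \<eta>y z0 0 = z0"
| "sim_gda gx gy \<eta>x \<eta>y z0 (Suc k) =
     (let z = sim_gda gx gy \<eta>x \<eta>y z0 k
      in (fst z - \<eta>x *\<^sub>R gx z, snd z + \<eta>y *\<^sub>R gy z))"

definition converges_linearly ::
    "('a::euclidean_space \<times> 'b::euclidean_space \<Rightarrow> real) \<Rightarrow>
     ('a \<times> 'b \<Rightarrow> 'a) \<Rightarrow> ('a \<times> 'b \<Rightarrow> 'b) \<Rightarrow> real \<Rightarrow> real \<Rightarrow> bool" where
  "converges_linearly f gx gy \<eta>x \<eta>y \<longleftrightarrow>
     (\<exists>C>0. \<exists>\<rho>. 0 \<le> \<rho> \<and> \<rho> < 1 \<and>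
       (\<forall>z0 k. norm (sim_gda gx gy \<eta>x \<eta>y z0 k - saddle_point f)
          \<le> C * \<rho> ^ k * norm (z0 - saddle_point f)))"

end

theory Submission
  imports Defs
begin

text \<open>Take \<open>f(x, y) = \<mu>/2 x\<^sup>2 + c x y - \<mu>/2 y\<^sup>2\<close> with \<open>c\<^sup>2 = L\<^sup>2 - \<mu>\<^sup>2\<close>. The linear map \<open>g\<close> is
  \<open>\<mu>\<close> times the identity plus \<open>c\<close> times a quarter turn, so \<open>norm (g z) = L * norm z\<close>. An error
  of size \<open>\<mu> * norm z \<le> \<alpha> * norm (g z)\<close> suffices to cancel the contracting part \<open>\<mu> z\<close>; what is
  left is a rotation field, along which an explicit step never decreases the norm.\<close>

definition quad_saddle :: "real \<Rightarrow> real \<Rightarrow> real \<times> real \<Rightarrow> real" where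
  "quad_saddle \<mu> c z = \<mu> / 2 * (fst z)\<^sup>2 + c * fst z * snd z - \<mu> / 2 * (snd z)\<^sup>2"

text \<open>In one dimension a gradient is an ordinary derivative, so uniqueness of derivatives
  evaluates the definite descriptions in \<open>grad_x\<close> and \<open>grad_y\<close>.\<close>

lemma the_GDERIV_real:
  fixes h :: "real \<Rightarrow> real"
  assumes "(h has_real_derivative d) (at x)"
  shows "(THE D. GDERIV h x :> D) = d"
  unfolding gderiv_deriv using assms DERIV_unique by blast

lemma norm_real_prod_sq: "(norm (z :: real \<times> real))\<^sup>2 = (fst z)\<^sup>2 + (snd z)\<^sup>2"
  by (simp add: norm_prod_def)

lemma grad_x_quad_saddle: "grad_x (quad_saddle \<mu> c) z = \<mu> * fst z + c * snd z"
  unfolding grad_x_def quad_saddle_def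
  by (rule the_GDERIV_real) (auto intro!: derivative_eq_intros)

lemma grad_y_quad_saddle: "grad_y (quad_saddle \<mu> c) z = c * fst z - \<mu> * snd z"
  unfolding grad_y_def quad_saddle_def
  by (rule the_GDERIV_real) (auto intro!: derivative_eq_intros)

lemmas saddle_grad_quad_saddle =
  saddle_grad_def grad_x_quad_saddle grad_y_quad_saddle

text \<open>The mixed terms \<open>2 * \<mu> * c * x * y\<close> of the two squared components have
  opposite signs and cancel.\<close>

lemma norm_saddle_grad_quad_saddle:
  "(norm (saddle_grad (quad_saddle \<mu> c) z))\<^sup>2 = (\<mu>\<^sup>2 + c\<^sup>2) * (norm z)\<^sup>2"
  unfolding norm_real_prod_sq by (simp add: saddle_grad_quad_saddle) algebra

text \<open>Linearity of the gradient map reduces both two-point conditions in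
  \<open>saddle_class\<close> to statements about a single vector.\<close>

lemma saddle_grad_quad_saddle_diff:
  "saddle_grad (quad_saddle \<mu> c) z1 - saddle_grad (quad_saddle \<mu> c) z0 =
    saddle_grad (quad_saddle \<mu> c) (z1 - z0)"
  by (simp add: saddle_grad_quad_saddle algebra_simps)

lemma continuously_differentiable_quad_saddle:
  "continuously_differentiable (quad_saddle \<mu> c)"
  unfolding continuously_differentiable_def
proof (intro exI conjI allI)
  show "GDERIV (quad_saddle \<mu> c) z :> (\<mu> * fst z + c * snd z, c * fst z - \<mu> * snd z)" for z
    unfolding gderiv_def quad_saddle_def
    by (auto intro!: derivative_eq_intros simp: inner_prod_def algebra_simps)
qed (auto intro!: continuous_intros)

lemma convex_on_quadratic:
  fixes a b c :: real
  assumes "0 \<le> a"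
  shows "convex_on UNIV (\<lambda>x. a * x\<^sup>2 + b * x + c)"
proof (rule f''_ge0_imp_convex)
  show "((\<lambda>x. a * x\<^sup>2 + b * x + c) has_real_derivative 2 * a * x + b) (at x)" for x
    by (auto intro!: derivative_eq_intros)
  show "((\<lambda>x. 2 * a * x + b) has_real_derivative 2 * a) (at x)" for x
    by (auto intro!: derivative_eq_intros)
qed (use assms in auto)

lemma quad_saddle_in_saddle_class:
  assumes "0 \<le> \<mu>" and "0 \<le> L" and "\<mu>\<^sup>2 + c\<^sup>2 = L\<^sup>2"
  shows "quad_saddle \<mu> c \<in> saddle_class \<mu> L"
proof -
  have "convex_on UNIV (\<lambda>x. quad_saddle \<mu> c (x, y))" for y
    using convex_on_quadratic[of "\<mu> / 2" "c * y" "- (\<mu> / 2 * y\<^sup>2)"] assms(1)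
    by (simp add: quad_saddle_def algebra_simps)
  \<comment> \<open>Concavity is convexity of the negated function, whose leading coefficient in
    \<open>y\<close> is again \<open>\<mu> / 2\<close>.\<close>
  moreover have "concave_on UNIV (\<lambda>y. quad_saddle \<mu> c (x, y))" for x
    using convex_on_quadratic[of "\<mu> / 2" "- (c * x)" "- (\<mu> / 2 * x\<^sup>2)"] assms(1)
    by (simp add: concave_on_def quad_saddle_def algebra_simps)
  \<comment> \<open>The part with \<open>c\<close> is skew, so it drops out of the inner product
    with \<open>z\<close>.\<close>
  moreover have "saddle_grad (quad_saddle \<mu> c) z \<bullet> z = \<mu> * (norm z)\<^sup>2" for z
    unfolding norm_real_prod_sq
    by (simp add: saddle_grad_quad_saddle inner_prod_def algebra_simps power2_eq_square)
  moreover have "norm (saddle_grad (quad_saddle \<mu> c) z) = L * norm z" for z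
  proof (rule power2_eq_imp_eq)
    show "(norm (saddle_grad (quad_saddle \<mu> c) z))\<^sup>2 = (L * norm z)\<^sup>2"
      by (simp only: norm_saddle_grad_quad_saddle assms(3) power_mult_distrib)
  qed (use assms(2) in simp_all)
  ultimately show ?thesis
    by (simp add: saddle_class_def saddle_grad_quad_saddle_diff
        continuously_differentiable_quad_saddle)
qed

lemma saddle_point_quad_saddle:
  assumes "\<mu> \<noteq> 0"
  shows "saddle_point (quad_saddle \<mu> c) = 0"
  unfolding saddle_point_def
proof (rule the_equality)
  show "saddle_grad (quad_saddle \<mu> c) 0 = 0"
    by (simp add: saddle_grad_quad_saddle zero_prod_def)
next
  fix z assume "saddle_grad (quad_saddle \<mu> c) z = 0"
  then have "(\<mu>\<^sup>2 + c\<^sup>2) * (norm z)\<^sup>2 = 0"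
    using norm_saddle_grad_quad_saddle[of \<mu> c z] by simp
  with assms show "z = 0" by simp
qed

text \<open>The errors are \<open>- \<mu> * x\<close> and \<open>\<mu> * y\<close>, of total square
  \<open>\<mu>\<^sup>2 * (norm z)\<^sup>2\<close>; the exact gradients have total square
  \<open>(\<mu>\<^sup>2 + c\<^sup>2) * (norm z)\<^sup>2\<close>. The assumption compares the two
  factors.\<close>

lemma inexact_gradients_rotation:
  assumes "\<mu>\<^sup>2 \<le> \<alpha>\<^sup>2 * (\<mu>\<^sup>2 + c\<^sup>2)"
  shows "inexact_gradients (quad_saddle \<mu> c) \<alpha> (\<lambda>z. c * snd z) (\<lambda>z. c * fst z)"
  unfolding inexact_gradients_def
proof
  fix z :: "real \<times> real"
  have "(norm (c * snd z - grad_x (quad_saddle \<mu> c) z))\<^sup>2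
      + (norm (c * fst z - grad_y (quad_saddle \<mu> c) z))\<^sup>2 = \<mu>\<^sup>2 * (norm z)\<^sup>2"
    unfolding norm_real_prod_sq
    by (simp add: grad_x_quad_saddle grad_y_quad_saddle algebra_simps)
  also have "\<dots> \<le> \<alpha>\<^sup>2 * (\<mu>\<^sup>2 + c\<^sup>2) * (norm z)\<^sup>2"
    by (intro mult_right_mono assms) simp
  also have "\<dots> = \<alpha>\<^sup>2 * (norm (saddle_grad (quad_saddle \<mu> c) z))\<^sup>2"
    by (simp add: norm_saddle_grad_quad_saddle)
  \<comment> \<open>The minus sign in the second component of \<open>saddle_grad\<close> disappears
    on squaring.\<close>
  also have "\<dots> = \<alpha>\<^sup>2 * ((norm (grad_x (quad_saddle \<mu> c) z))\<^sup>2
      + (norm (grad_y (quad_saddle \<mu> c) z))\<^sup>2)"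
    unfolding norm_real_prod_sq by (simp add: saddle_grad_def)
  finally show "(norm (c * snd z - grad_x (quad_saddle \<mu> c) z))\<^sup>2
      + (norm (c * fst z - grad_y (quad_saddle \<mu> c) z))\<^sup>2
      \<le> \<alpha>\<^sup>2 * ((norm (grad_x (quad_saddle \<mu> c) z))\<^sup>2
        + (norm (grad_y (quad_saddle \<mu> c) z))\<^sup>2)" .
qed

text \<open>Each step adds a vector orthogonal to the current iterate, so by Pythagoras the squared
  norm is multiplied by \<open>1 + (\<eta> * c)\<^sup>2\<close>.\<close>

lemma norm_sim_gda_rotation_ge:
  fixes z0 :: "real \<times> real"
  shows "norm z0 \<le> norm (sim_gda (\<lambda>z. c * snd z) (\<lambda>z. c * fst z) \<eta> \<eta> z0 k)"
proof (induction k)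
  case (Suc k)
  define z where "z = sim_gda (\<lambda>z. c * snd z) (\<lambda>z. c * fst z) \<eta> \<eta> z0 k"
  let ?z' = "(fst z - \<eta> * (c * snd z), snd z + \<eta> * (c * fst z))"
  have "(norm ?z')\<^sup>2 = (norm z)\<^sup>2 + (\<eta> * c)\<^sup>2 * (norm z)\<^sup>2"
    unfolding norm_real_prod_sq by simp algebra
  then have "(norm z)\<^sup>2 \<le> (norm ?z')\<^sup>2"
    by (simp only: le_add_same_cancel1) simp
  then have "norm z \<le> norm ?z'"
    by (rule power2_le_imp_le) (rule norm_ge_zero)
  with Suc show ?case
    by (simp add: z_def Let_def)
qed simp

text \<open>One starting point suffices: the geometric bound tends to 0 as \<open>k\<close> grows,
  while the distance to the saddle point stays above a positive constant.\<close>

lemma not_converges_linearly_if_norm_ge: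
  assumes "z0 \<noteq> saddle_point f"
    and "\<And>k. norm (z0 - saddle_point f) \<le> norm (sim_gda gx gy \<eta>x \<eta>y z0 k - saddle_point f)"
  shows "\<not> converges_linearly f gx gy \<eta>x \<eta>y"
proof
  let ?d = "norm (z0 - saddle_point f)"
  assume "converges_linearly f gx gy \<eta>x \<eta>y"
  then obtain C \<rho> where \<rho>: "0 \<le> \<rho>" "\<rho> < 1"
    and bound: "\<And>k. norm (sim_gda gx gy \<eta>x \<eta>y z0 k - saddle_point f) \<le> C * \<rho> ^ k * ?d"
    unfolding converges_linearly_def by blast
  have "(\<lambda>k. C * \<rho> ^ k * ?d) \<longlonglongrightarrow> C * 0 * ?d"
    by (intro tendsto_intros LIMSEQ_realpow_zero \<rho>)
  then have "?d \<le> C * 0 * ?d"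
    by (rule LIMSEQ_le_const) (use order_trans[OF assms(2) bound] in blast)
  with assms(1) show False by simp
qed

theorem theorem9:
  fixes \<mu> L :: real
  assumes "0 < \<mu>" and "\<mu> \<le> L"
  shows "\<exists>f :: real \<times> real \<Rightarrow> real. f \<in> saddle_class \<mu> L \<and>
    (\<forall>\<alpha>. 0 \<le> \<alpha> \<and> \<alpha> < 1 \<and> \<mu> / L \<le> \<alpha> \<longrightarrow>
      (\<exists>gx gy. inexact_gradients f \<alpha> gx gy \<and>
        (\<forall>\<eta>>0. \<not> converges_linearly f gx gy \<eta> \<eta>)))"
proof -
  \<comment> \<open>This choice makes the gradient map scale norms by exactly \<open>L\<close>; the
    radicand is nonnegative because \<open>\<mu> \<le> L\<close>.\<close>
  define c where "c = sqrt (L\<^sup>2 - \<mu>\<^sup>2)"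
  have c: "\<mu>\<^sup>2 + c\<^sup>2 = L\<^sup>2"
    using assms by (simp add: c_def power_mono)
  have "\<exists>gx gy. inexact_gradients (quad_saddle \<mu> c) \<alpha> gx gy \<and>
      (\<forall>\<eta>>0. \<not> converges_linearly (quad_saddle \<mu> c) gx gy \<eta> \<eta>)"
    if "\<mu> / L \<le> \<alpha>" for \<alpha>
  proof (intro exI conjI allI impI)
    \<comment> \<open>The threshold on \<alpha> says that the allowed error, \<alpha> times the
      gradient norm \<open>L * norm z\<close>, covers the contracting part
      \<open>\<mu> * z\<close>.\<close>
    have "\<mu> \<le> \<alpha> * L"
      using that assms by (simp add: field_simps)
    then have "\<mu>\<^sup>2 \<le> (\<alpha> * L)\<^sup>2"
      using assms by (intro power_mono) auto
    then show "inexact_gradients (quad_saddle \<mu> c) \<alpha> (\<lambda>z. c * snd z) (\<lambda>z. c * fst z)"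
      by (intro inexact_gradients_rotation) (simp add: c power_mult_distrib)
    show "\<not> converges_linearly (quad_saddle \<mu> c) (\<lambda>z. c * snd z) (\<lambda>z. c * fst z) \<eta> \<eta>" for \<eta>
    proof (rule not_converges_linearly_if_norm_ge)
      have "saddle_point (quad_saddle \<mu> c) = 0"
        using assms by (simp add: saddle_point_quad_saddle)
      then show "(1, 0) \<noteq> saddle_point (quad_saddle \<mu> c)"
        and "norm ((1, 0) - saddle_point (quad_saddle \<mu> c)) \<le>
          norm (sim_gda (\<lambda>z. c * snd z) (\<lambda>z. c * fst z) \<eta> \<eta> (1, 0) k
            - saddle_point (quad_saddle \<mu> c))" for k
        by (simp_all only: diff_zero norm_sim_gda_rotation_ge) (simp add: prod_eq_iff)
    qed
  qed
  moreover have "quad_saddle \<mu> c \<in> saddle_class \<mu> L"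
    using assms c by (intro quad_saddle_in_saddle_class) auto
  ultimately show ?thesis by blast
qed

end
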